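(* Let $D_{16}=\begin{pmatrix} A_1 & A_2\\ -A_2^T & A_1^T\end{pmatrix}$ where $A_1,A_2$ are the $8\times 8$ negacirculant integer matrices with first rows $(0,1,1,0,1,0,1,1)$ and $(1,1,1,-1,-1,2,-1,0)$, respectively. Let $C$ be the $\mathbb{Z}_4$-code of length $32$ generated by the rows of $(I_{16}\ \ D_{16}+2I_{16})$ read modulo $4$, and let $L=A_4(C)$. Then for a positive integer $k$, $L$ contains a $k$-frame if and only if $k\ge 4$.
   Context: An $m\times m$ matrix is negacirculant if its first row is $(r_0,\dots,r_{m-1})$ and its $(i,j)$ entry is $r_{j-i}$ if $j\ge i$ and $-r_{m+j-i}$ if $j<i$. For a $\mathbb{Z}_k$-code $C$ of length $n$, Construction A gives $A_k(C)=\frac{1}{\sqrt{k}}\{x\in\mathbb{Z}^n : (x_1 \bmod k,\dots,x_n\bmod k)\in C\}$. Here $C$ is self-dual and $L$ is an odd unimodular lattice of dimension $32$ with minimum norm $4$ (an extremal odd unimodular lattice). A $k$-frame of a lattice $L$ of dimension $n$ is a set of $n$ vectors $f_1,\dots,f_n\in L$ with $(f_i,f_j)=k\delta_{i,j}$, where $(\cdot,\cdot)$ is the standard inner product. *)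

theory Defs
  imports Complex_Main "Jordan_Normal_Form.Matrix"
begin

definition negacirculant :: "int list \<Rightarrow> int mat" where
  "negacirculant r = (let m = length r in
     mat m m (\<lambda>(i, j). if i \<le> j then r ! (j - i) else - r ! (m + j - i)))"

definition hconcat_mat :: "'a mat \<Rightarrow> 'a mat \<Rightarrow> 'a mat" where
  "hconcat_mat A B = mat (dim_row A) (dim_col A + dim_col B)
     (\<lambda>(i, j). if j < dim_col A then A $$ (i, j) else B $$ (i, j - dim_col A))"

text \<open>Elements of \<open>\<int>\<^sub>k\<close> are represented by their residues in \<open>{0..<k}\<close>, so a
  \<open>\<int>\<^sub>k\<close>-code of length \<open>n\<close> is a set of integer vectors of dimension \<open>n\<close> with entries in that range.\<close>

definition mod_vec :: "nat \<Rightarrow> int vec \<Rightarrow> int vec" where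
  "mod_vec k x = map_vec (\<lambda>a. a mod int k) x"

text \<open>The \<open>\<int>\<^sub>k\<close>-linear combinations of the rows of \<open>G\<close>: the vector \<open>G\<^sup>T u\<close> is the combination of
  the rows with coefficients \<open>u\<close>.\<close>

definition code_generated_by :: "nat \<Rightarrow> int mat \<Rightarrow> int vec set" where
  "code_generated_by k G = {mod_vec k (G\<^sup>T *\<^sub>v u) |u. u \<in> carrier_vec (dim_row G)}"

definition construction_A :: "nat \<Rightarrow> nat \<Rightarrow> int vec set \<Rightarrow> real vec set" where
  "construction_A n k C =
     {(1 / sqrt (real k)) \<cdot>\<^sub>v map_vec real_of_int x |x. x \<in> carrier_vec n \<and> mod_vec k x \<in> C}"

definition is_frame :: "nat \<Rightarrow> nat \<Rightarrow> real vec set \<Rightarrow> (nat \<Rightarrow> real vec) \<Rightarrow> bool" where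
  "is_frame n k L f \<longleftrightarrow> (\<forall>i<n. f i \<in> L) \<and>
     (\<forall>i<n. \<forall>j<n. f i \<bullet> f j = (if i = j then real k else 0))"

definition contains_frame :: "nat \<Rightarrow> nat \<Rightarrow> real vec set \<Rightarrow> bool" where
  "contains_frame n k L \<longleftrightarrow> (\<exists>f. is_frame n k L f)"

definition D16 :: "int mat" where
  "D16 = (let A1 = negacirculant [0, 1, 1, 0, 1, 0, 1, 1];
              A2 = negacirculant [1, 1, 1, -1, -1, 2, -1, 0]
          in four_block_mat A1 A2 (- (A2\<^sup>T)) (A1\<^sup>T))"

definition C32 :: "int vec set" where
  "C32 = code_generated_by 4 (hconcat_mat (1\<^sub>m 16) (D16 + 2 \<cdot>\<^sub>m 1\<^sub>m 16))"

definition L32 :: "real vec set" where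
  "L32 = construction_A 32 4 C32"

end

theory Submission
  imports Defs "HOL-Computational_Algebra.Primes" "HOL-Number_Theory.Cong"
begin

text \<open>
  Write \<open>D\<close> for \<open>D16\<close> and \<open>E = D + 2\<close>. The matrix \<open>D\<close> is skew-symmetric with \<open>D\<^sup>2 = -15\<close>, hence
  \<open>E E\<^sup>T = 19\<close> and \<open>E\<^sup>2 \<equiv> 1\<close> modulo 4. Up to the scaling by 1/2, the lattice consists of the integer
  vectors \<open>(u, v)\<close> with \<open>v \<equiv> u E\<close> modulo 4, so a \<open>k\<close>-frame is an integer \<open>32 \<times> 32\<close> matrix \<open>N\<close> with
  rows of this form and \<open>N N\<^sup>T = 4 k\<close>.

  Negacirculant block matrices of the shape of \<open>D\<close> commute with a copy of the quaternion units
  \<open>I, J, K\<close>, realized by signed permutation matrices. With \<open>q = s + x I + y J + z K\<close>, the matrix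
  \<open>N = (q, v + w D; -v + w D, q\<^sup>T)\<close> satisfies \<open>N N\<^sup>T = s\<^sup>2 + x\<^sup>2 + y\<^sup>2 + z\<^sup>2 + v\<^sup>2 + 15 w\<^sup>2\<close>, and its rows
  belong to the code when \<open>x, y, z\<close> are divisible by 4, \<open>s \<equiv> w\<close> and \<open>v \<equiv> 2 w\<close> modulo 4. By Lagrange's
  four-square theorem this yields all odd \<open>k \<ge> 5\<close> (\<open>w = 1\<close>) and all multiples of 4 (\<open>w = v = 0\<close>).
  Replacing orthogonal pairs \<open>f, g\<close> by \<open>f + g, f - g\<close> turns a \<open>k\<close>-frame into a \<open>2 k\<close>-frame, which
  leaves only \<open>k = 6\<close>.

  For \<open>k < 4\<close>, a vector of norm \<open>k\<close> would give \<open>(u, v)\<close> with \<open>|u|\<^sup>2 + |v|\<^sup>2 = 4 k \<le> 12\<close>. Since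
  \<open>|v|\<^sup>2 \<equiv> 3 |u|\<^sup>2\<close> modulo 8 excludes \<open>|u|\<^sup>2 = |v|\<^sup>2 = 6\<close>, and \<open>(v, u)\<close> lies in the lattice as well, one
  may assume \<open>|u|\<^sup>2 \<le> 5\<close>; these \<open>u\<close> are enumerated modulo 4.
\<close>

section \<open>Lagrange's four-square theorem\<close>


definition sum4sq :: "int \<Rightarrow> bool" where
  "sum4sq n \<longleftrightarrow> (\<exists>a b c d. n = a^2 + b^2 + c^2 + d^2)"

lemma sum4sqI: "n = a^2 + b^2 + c^2 + d^2 \<Longrightarrow> sum4sq n"
  unfolding sum4sq_def by blast

lemma euler_four_square:
  fixes a b c d w x y z :: int
  shows "(a^2 + b^2 + c^2 + d^2) * (w^2 + x^2 + y^2 + z^2) =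
    (a*w + b*x + c*y + d*z)^2 + (a*x - b*w + c*z - d*y)^2
    + (a*y - c*w + d*x - b*z)^2 + (a*z - d*w + b*y - c*x)^2"
  by (simp add: power2_eq_square algebra_simps)

lemma sum4sq_mult: "sum4sq m \<Longrightarrow> sum4sq n \<Longrightarrow> sum4sq (m * n)"
  unfolding sum4sq_def using euler_four_square by metis

text \<open>An even sum of squares lets its terms be paired by parity, and
  \<open>(a^2 + b^2) / 2 = ((a + b) / 2)^2 + ((a - b) / 2)^2\<close>.\<close>

lemma sum4sq_half:
  assumes "sum4sq (2 * n)"
  shows "sum4sq n"
proof -
  have same: "sum4sq n" if h: "2 * n = a^2 + b^2 + c^2 + d^2" "even (a - b)" "even (c - d)" for a b c d :: int
  proof -
    obtain r s where "a - b = 2 * r" "c - d = 2 * s" using h(2,3) unfolding dvd_def by blast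
    then have "a = b + 2 * r" "c = d + 2 * s" by simp_all
    then have "n = (b + r)^2 + r^2 + (d + s)^2 + s^2"
      using h(1) by (simp add: power2_eq_square algebra_simps)
    then show ?thesis by (rule sum4sqI)
  qed
  obtain a b c d where *: "2 * n = a^2 + b^2 + c^2 + d^2"
    using assms unfolding sum4sq_def by blast
  then have "even (a^2 + b^2 + c^2 + d^2)" by (metis dvd_triv_left)
  then have "even (a - b) \<and> even (c - d) \<or> even (a - c) \<and> even (b - d) \<or> even (a - d) \<and> even (b - c)"
    by auto
  then show ?thesis
    using same[of a b c d] same[of a c b d] same[of a d b c] * by linarith
qed

text \<open>Residues centred at 0: for odd \<open>m\<close> the value \<open>m / 2\<close> cannot
  occur, which makes the bound strict, as the descent requires.\<close>

lemma odd_residue: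
  fixes a m :: int
  assumes "odd m" "m > 0"
  obtains q r where "a = m * q + r" "4 * r^2 < m^2"
proof -
  obtain h where h: "m = 2 * h + 1" using assms by (auto elim: oddE)
  define r where "r = (a + h) mod m - h"
  have b: "0 \<le> (a + h) mod m" "(a + h) mod m < m" using assms by auto
  have "\<bar>2 * r\<bar> < m" using b h unfolding r_def by auto
  then have "4 * r^2 < m^2"
    using power_strict_mono[of "\<bar>2 * r\<bar>" m 2] by (simp add: power_mult_distrib)
  moreover have "a = m * ((a + h) div m) + r"
    unfolding r_def using mult_div_mod_eq[of m "a + h"] by linarith
  ultimately show thesis using that by blast
qed

text \<open>Descent on the multiplier: an even \<open>m\<close> is halved, and an odd
  \<open>m > 1\<close> is replaced by a smaller \<open>r\<close> through Euler's identity, applied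
  to a representation of \<open>m * p\<close> and its residues modulo \<open>m\<close>.\<close>

lemma sum4sq_descent:
  fixes p m :: nat
  assumes "prime p" "0 < m" "m < p" "sum4sq (int m * int p)"
  shows "sum4sq (int p)"
  using assms(2-)
proof (induction m rule: less_induct)
  case (less m)
  show ?case
  proof (cases "m = 1 \<or> even m")
    case True
    then show ?thesis
    proof
      assume "m = 1"
      then show ?thesis using less.prems by simp
    next
      assume "even m"
      then obtain h where h: "m = 2 * h" by blast
      then have "sum4sq (int h * int p)"
        using less.prems sum4sq_half[of "int h * int p"] by (simp add: mult.assoc)
      then show ?thesis using less.IH[of h] less.prems h by auto
    qed
  next
    case False
    then have m: "odd (int m)" "int m > 0" "m > 1" using less.prems by auto
    obtain a b c d where abcd: "int m * int p = a^2 + b^2 + c^2 + d^2"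
      using less.prems unfolding sum4sq_def by blast
    obtain q1 w where w: "a = int m * q1 + w" "4 * w^2 < (int m)^2" using odd_residue[OF m(1,2)] .
    obtain q2 x where x: "b = int m * q2 + x" "4 * x^2 < (int m)^2" using odd_residue[OF m(1,2)] .
    obtain q3 y where y: "c = int m * q3 + y" "4 * y^2 < (int m)^2" using odd_residue[OF m(1,2)] .
    obtain q4 z where z: "d = int m * q4 + z" "4 * z^2 < (int m)^2" using odd_residue[OF m(1,2)] .
    define r where "r = int p - (2 * (q1 * w + q2 * x + q3 * y + q4 * z)
        + int m * (q1^2 + q2^2 + q3^2 + q4^2))"
    have r: "w^2 + x^2 + y^2 + z^2 = int m * r"
      using abcd unfolding r_def w(1) x(1) y(1) z(1) by (simp add: power2_eq_square algebra_simps)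
    have "int m * r < int m * int m" using w x y z r by (simp add: power2_eq_square)
    then have rm: "r < int m" using m by simp
    have "int m * r \<ge> 0" using r by (metis add_nonneg_nonneg zero_le_power2)
    then have r0: "r \<ge> 0" using m by (simp add: zero_le_mult_iff)
    have "r \<noteq> 0"
    proof
      assume "r = 0"
      then have "w = 0 \<and> x = 0 \<and> y = 0 \<and> z = 0"
        using r by (simp add: add_nonneg_eq_0_iff)
      then have "int m * int p = int m * (int m * (q1^2 + q2^2 + q3^2 + q4^2))"
        using abcd w x y z by (simp add: power2_eq_square algebra_simps)
      then have "int p = int m * (q1^2 + q2^2 + q3^2 + q4^2)" using m by simp
      then have "m dvd p" by (metis dvd_triv_left int_dvd_int_iff)
      then show False using \<open>prime p\<close> m less.prems by (auto simp: prime_nat_iff)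
    qed
    have 1: "a*w + b*x + c*y + d*z = int m * (r + q1*w + q2*x + q3*y + q4*z)"
    proof -
      have "a*w + b*x + c*y + d*z = int m * (q1*w + q2*x + q3*y + q4*z) + (w^2 + x^2 + y^2 + z^2)"
        using w x y z by (simp add: power2_eq_square algebra_simps)
      then show ?thesis using r by (simp add: algebra_simps)
    qed
    have 2: "a*x - b*w + c*z - d*y = int m * (q1*x - q2*w + q3*z - q4*y)"
      using w x y z by (simp add: algebra_simps)
    have 3: "a*y - c*w + d*x - b*z = int m * (q1*y - q3*w + q4*x - q2*z)"
      using w x y z by (simp add: algebra_simps)
    have 4: "a*z - d*w + b*y - c*x = int m * (q1*z - q4*w + q2*y - q3*x)"
      using w x y z by (simp add: algebra_simps)
    \<comment> \<open>All four terms of Euler's identity are multiples of \<open>m\<close>, so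
      \<open>m^2\<close> cancels.\<close>
    have "(int m * int p) * (int m * r) = (int m)^2 * ((r + q1*w + q2*x + q3*y + q4*z)^2
        + (q1*x - q2*w + q3*z - q4*y)^2 + (q1*y - q3*w + q4*x - q2*z)^2
        + (q1*z - q4*w + q2*y - q3*x)^2)"
      unfolding abcd r[symmetric] euler_four_square 1 2 3 4 power_mult_distrib[of "int m"]
      by (simp only: distrib_left[of "(int m)^2"])
    then have "(int m)^2 * (r * int p) = (int m)^2 * ((r + q1*w + q2*x + q3*y + q4*z)^2
        + (q1*x - q2*w + q3*z - q4*y)^2 + (q1*y - q3*w + q4*x - q2*z)^2
        + (q1*z - q4*w + q2*y - q3*x)^2)"
      by (simp only: power2_eq_square ac_simps)
    then have "r * int p = (r + q1*w + q2*x + q3*y + q4*z)^2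
        + (q1*x - q2*w + q3*z - q4*y)^2 + (q1*y - q3*w + q4*x - q2*z)^2
        + (q1*z - q4*w + q2*y - q3*x)^2"
      using m by simp
    then have "sum4sq (int (nat r) * int p)" using r0 by (intro sum4sqI) simp
    then show ?thesis using less.IH[of "nat r"] r0 rm \<open>r \<noteq> 0\<close> less.prems by simp
  qed
qed

text \<open>Pigeonhole: on \<open>0, ..., (p - 1) / 2\<close> the maps \<open>x^2\<close> and
  \<open>-1 - y^2\<close> each take \<open>(p + 1) / 2\<close> distinct values modulo
  \<open>p\<close>, so they share one.\<close>

lemma prime_dvd_two_squares_plus_one:
  fixes p :: nat
  assumes "prime p" "odd p"
  obtains x y :: int where "4 * x^2 < (int p)^2" "4 * y^2 < (int p)^2" "int p dvd x^2 + y^2 + 1"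
proof -
  obtain h where h: "p = 2 * h + 1" using assms by (auto elim: oddE)
  define S where "S = {0..int h}"
  define f where "f x = x^2 mod int p" for x
  define g where "g x = (- 1 - x^2) mod int p" for x
  have pp: "prime (int p)" using assms by simp
  have inj: "x = y" if "x \<in> S" "y \<in> S" "int p dvd x^2 - y^2" for x y
  proof -
    have "int p dvd (x - y) * (x + y)" using that(3) by (simp add: power2_eq_square algebra_simps)
    then have "int p dvd x - y \<or> int p dvd x + y" using pp prime_dvd_mult_iff by blast
    then show ?thesis
    proof
      assume "int p dvd x - y"
      moreover have "\<bar>x - y\<bar> < \<bar>int p\<bar>" using that h unfolding S_def by auto
      ultimately show ?thesis using dvd_imp_le_int[of "x - y" "int p"] by fastforce
    next
      assume "int p dvd x + y"
      moreover have "\<bar>x + y\<bar> < \<bar>int p\<bar>" using that h unfolding S_def by auto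
      ultimately have "x + y = 0" using dvd_imp_le_int[of "x + y" "int p"] by fastforce
      then show ?thesis using that unfolding S_def by auto
    qed
  qed
  have "inj_on f S" using inj unfolding inj_on_def f_def by (metis mod_eq_dvd_iff)
  moreover have "inj_on g S"
  proof (rule inj_onI)
    fix x y assume *: "x \<in> S" "y \<in> S" "g x = g y"
    then have "int p dvd (- 1 - x^2) - (- 1 - y^2)" unfolding g_def by (simp only: mod_eq_dvd_iff)
    then have "int p dvd y^2 - x^2" by simp
    then show "x = y" using inj[of y x] * by simp
  qed
  ultimately have c: "card (f ` S) = h + 1" "card (g ` S) = h + 1" unfolding S_def by (simp_all add: card_image)
  have sub: "f ` S \<union> g ` S \<subseteq> {0..<int p}" using h unfolding f_def g_def by auto
  have "f ` S \<inter> g ` S \<noteq> {}"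
  proof
    assume e: "f ` S \<inter> g ` S = {}"
    have "card (f ` S \<union> g ` S) = 2 * h + 2"
      using e c by (subst card_Un_disjoint) (auto simp: S_def)
    moreover have "card (f ` S \<union> g ` S) \<le> p"
      using card_mono[OF _ sub] by simp
    ultimately show False using h by simp
  qed
  then obtain x y where xy: "x \<in> S" "y \<in> S" "f x = g y" by blast
  have "int p dvd x^2 - (- 1 - y^2)" using xy(3) unfolding f_def g_def by (simp only: mod_eq_dvd_iff)
  moreover have "4 * x^2 < (int p)^2" if "x \<in> S" for x
    using power_strict_mono[of "2 * x" "int p" 2] that h unfolding S_def by (simp add: power_mult_distrib)
  ultimately show thesis using that[of x y] xy by (simp add: algebra_simps)
qed

lemma sum4sq_prime:
  fixes p :: nat
  assumes "prime p"
  shows "sum4sq (int p)"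
proof (cases "p = 2")
  case True
  then show ?thesis by (intro sum4sqI[of _ 1 1 0 0]) simp
next
  case False
  then have "odd p" "p > 2" using assms prime_odd_nat prime_ge_2_nat[OF assms] by auto
  then obtain x y where xy: "4 * x^2 < (int p)^2" "4 * y^2 < (int p)^2" "int p dvd x^2 + y^2 + 1"
    using prime_dvd_two_squares_plus_one assms by blast
  then obtain m where m: "x^2 + y^2 + 1 = int p * m" by blast
  \<comment> \<open>Since \<open>x^2 + y^2 < p^2 / 2\<close>, the extra 1 is absorbed for
    \<open>p >= 3\<close>, and the multiplier stays below \<open>p\<close>.\<close>
  have "9 \<le> (int p)^2" using \<open>p > 2\<close> power_mono[of 3 "int p" 2] by simp
  then have "int p * m < int p * int p" using m xy by (simp add: power2_eq_square)
  then have "m < int p" using \<open>p > 2\<close> by simp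
  moreover have "int p * m > 0" using m by (smt (verit) zero_le_power2)
  then have "m > 0" using \<open>p > 2\<close> by (simp add: zero_less_mult_iff)
  moreover have "sum4sq (m * int p)" using m by (intro sum4sqI[of _ x y 1 0]) (simp add: mult.commute)
  ultimately show ?thesis using sum4sq_descent[of p "nat m"] assms by simp
qed

theorem lagrange_four_squares: "sum4sq (int n)"
proof (induction n rule: less_induct)
  case (less n)
  consider "n = 0" | "n = 1" | "n > 1" by linarith
  then show ?case
  proof cases
    case 3
    then obtain p where p: "prime p" "p dvd n" using prime_factor_nat[of n] by auto
    then obtain m where m: "n = p * m" by blast
    then have "m < n" using 3 prime_gt_1_nat[OF p(1)] by (cases "m = 0") auto
    then show ?thesis using less sum4sq_mult sum4sq_prime[OF p(1)] m by simp
  qed (auto intro: sum4sqI[of _ 0 0 0 0] sum4sqI[of _ 1 0 0 0])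
qed



section \<open>The lattice in integer coordinates\<close>

definition D_rows :: "int list list" where
  "D_rows = [[0, 1, 1, 0, 1, 0, 1, 1, 1, 1, 1, -1, -1, 2, -1, 0],
   [-1, 0, 1, 1, 0, 1, 0, 1, 0, 1, 1, 1, -1, -1, 2, -1],
   [-1, -1, 0, 1, 1, 0, 1, 0, 1, 0, 1, 1, 1, -1, -1, 2],
   [0, -1, -1, 0, 1, 1, 0, 1, -2, 1, 0, 1, 1, 1, -1, -1],
   [-1, 0, -1, -1, 0, 1, 1, 0, 1, -2, 1, 0, 1, 1, 1, -1],
   [0, -1, 0, -1, -1, 0, 1, 1, 1, 1, -2, 1, 0, 1, 1, 1],
   [-1, 0, -1, 0, -1, -1, 0, 1, -1, 1, 1, -2, 1, 0, 1, 1],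
   [-1, -1, 0, -1, 0, -1, -1, 0, -1, -1, 1, 1, -2, 1, 0, 1],
   [-1, 0, -1, 2, -1, -1, 1, 1, 0, -1, -1, 0, -1, 0, -1, -1],
   [-1, -1, 0, -1, 2, -1, -1, 1, 1, 0, -1, -1, 0, -1, 0, -1],
   [-1, -1, -1, 0, -1, 2, -1, -1, 1, 1, 0, -1, -1, 0, -1, 0],
   [1, -1, -1, -1, 0, -1, 2, -1, 0, 1, 1, 0, -1, -1, 0, -1],
   [1, 1, -1, -1, -1, 0, -1, 2, 1, 0, 1, 1, 0, -1, -1, 0],
   [-2, 1, 1, -1, -1, -1, 0, -1, 0, 1, 0, 1, 1, 0, -1, -1],
   [1, -2, 1, 1, -1, -1, -1, 0, 1, 0, 1, 0, 1, 1, 0, -1],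
   [0, 1, -2, 1, 1, -1, -1, -1, 1, 1, 0, 1, 0, 1, 1, 0]]"

text \<open>The rows of \<open>v + w D\<close>; overwriting the diagonal is correct because that of \<open>D\<close> is zero.\<close>

definition D_shift :: "int \<Rightarrow> int \<Rightarrow> int list list" where
  "D_shift v w = map2 (\<lambda>i r. (map ((*) w) r)[i := v]) [0..<16] D_rows"

definition E_rows :: "int list list" where
  "E_rows = D_shift 2 1"

abbreviation E_entry :: "nat \<Rightarrow> nat \<Rightarrow> int" where
  "E_entry i j \<equiv> E_rows ! i ! j"

text \<open>The generator matrix is systematic, so the first half of a codeword is its coefficient
  vector. Vectors are functions of which only the values below 32 matter.\<close>

definition codeword :: "(nat \<Rightarrow> int) \<Rightarrow> bool" where
  "codeword x \<longleftrightarrow> (\<forall>j<16. [x (16 + j) = (\<Sum>i<16. x i * E_entry i j)] (mod 4))"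

section \<open>Comparison of the integer table with the matrices of the statement\<close>

lemma negacirculant_index:
  assumes "i < length r" "j < length r"
  shows "negacirculant r $$ (i, j) = (if i \<le> j then r ! (j - i) else - r ! (length r + j - i))"
  using assms by (simp add: negacirculant_def Let_def)

lemma negacirculant_carrier: "negacirculant r \<in> carrier_mat (length r) (length r)"
  by (simp add: negacirculant_def Let_def)

text \<open>Free of the matrix type, so that \<open>E_rows\<close> can be compared with
  \<open>D16\<close> by evaluation.\<close>

definition negacirculant_entry :: "int list \<Rightarrow> nat \<Rightarrow> nat \<Rightarrow> int" where
  "negacirculant_entry r i j = (if i \<le> j then r ! (j - i) else - r ! (length r + j - i))"

definition block_entry :: "int list \<Rightarrow> int list \<Rightarrow> nat \<Rightarrow> nat \<Rightarrow> int" where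
  "block_entry a b i j =
     (if i < 8 then if j < 8 then negacirculant_entry a i j else negacirculant_entry b i (j - 8)
      else if j < 8 then - negacirculant_entry b j (i - 8)
      else negacirculant_entry a (j - 8) (i - 8))"

lemma negacirculant_block:
  fixes a b :: "int list"
  defines "A \<equiv> negacirculant a" and "B \<equiv> negacirculant b"
  assumes len: "length a = 8" "length b = 8"
  shows "four_block_mat A B (- (B\<^sup>T)) (A\<^sup>T) \<in> carrier_mat 16 16"
    and "i < 16 \<Longrightarrow> j < 16 \<Longrightarrow>
      four_block_mat A B (- (B\<^sup>T)) (A\<^sup>T) $$ (i, j) = block_entry a b i j"
proof -
  have A: "A \<in> carrier_mat 8 8" and B: "B \<in> carrier_mat 8 8"
    unfolding A_def B_def using negacirculant_carrier len by metis+
  then show "four_block_mat A B (- (B\<^sup>T)) (A\<^sup>T) \<in> carrier_mat 16 16"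
    by (intro carrier_matI) auto
  have e: "A $$ (i, j) = negacirculant_entry a i j" "B $$ (i, j) = negacirculant_entry b i j"
    if "i < 8" "j < 8" for i j
    using that len negacirculant_index by (auto simp: A_def B_def negacirculant_entry_def)
  show "four_block_mat A B (- (B\<^sup>T)) (A\<^sup>T) $$ (i, j) = block_entry a b i j"
    if "i < 16" "j < 16"
    using that carrier_matD[OF A] carrier_matD[OF B] by (auto simp: e block_entry_def)
qed

definition D16_entry :: "nat \<Rightarrow> nat \<Rightarrow> int" where
  "D16_entry = block_entry [0, 1, 1, 0, 1, 0, 1, 1] [1, 1, 1, -1, -1, 2, -1, 0]"

lemma D16_carrier: "D16 \<in> carrier_mat 16 16"
  unfolding D16_def Let_def by (rule negacirculant_block) simp_all

lemma D16_index: "i < 16 \<Longrightarrow> j < 16 \<Longrightarrow> D16 $$ (i, j) = D16_entry i j"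
  unfolding D16_def Let_def D16_entry_def by (rule negacirculant_block) simp_all

lemma E_rows_entries:
  "\<forall>i\<in>set [0..<16]. \<forall>j\<in>set [0..<16].
     E_rows ! i ! j = D16_entry i j + (if i = j then 2 else 0)"
  by code_simp

lemma generator_index:
  assumes "i < 16" "j < 32"
  shows "hconcat_mat (1\<^sub>m 16) (D16 + 2 \<cdot>\<^sub>m 1\<^sub>m 16) $$ (i, j)
    = (if j < 16 then if i = j then 1 else 0 else E_entry i (j - 16))"
proof -
  have "E_entry i (j - 16) = D16_entry i (j - 16) + (if i = j - 16 then 2 else 0)"
    using E_rows_entries assms by (cases "j < 16") auto
  then show ?thesis
    using assms D16_carrier by (auto simp: hconcat_mat_def D16_index)
qed



lemma generator_combination_index:
  assumes "u \<in> carrier_vec 16" "j < 32"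
  shows "((hconcat_mat (1\<^sub>m 16) (D16 + 2 \<cdot>\<^sub>m 1\<^sub>m 16))\<^sup>T *\<^sub>v u) $ j
    = (if j < 16 then u $ j else (\<Sum>i<16. u $ i * E_entry i (j - 16)))"
proof -
  let ?G = "hconcat_mat (1\<^sub>m 16) (D16 + 2 \<cdot>\<^sub>m 1\<^sub>m 16)"
  have dim: "dim_row ?G = 16" "dim_col ?G = 32"
    using D16_carrier by (auto simp: hconcat_mat_def)
  have "(?G\<^sup>T *\<^sub>v u) $ j = (\<Sum>i<16. ?G $$ (i, j) * u $ i)"
    using assms dim by (auto simp: scalar_prod_def lessThan_atLeast0 intro!: sum.cong)
  also have "\<dots> = (\<Sum>i<16. u $ i * (if j < 16 then if i = j then 1 else 0 else E_entry i (j - 16)))"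
    using assms by (intro sum.cong) (auto simp: generator_index)
  also have "\<dots> = (if j < 16 then u $ j else (\<Sum>i<16. u $ i * E_entry i (j - 16)))"
    by (cases "j < 16") (simp_all add: if_distrib[of "(*) _"] cong: if_cong)
  finally show ?thesis .
qed

lemma mod_vec_in_C32_iff:
  assumes x: "x \<in> carrier_vec 32"
  shows "mod_vec 4 x \<in> C32 \<longleftrightarrow> codeword (\<lambda>i. x $ i)"
proof
  let ?G = "hconcat_mat (1\<^sub>m 16) (D16 + 2 \<cdot>\<^sub>m 1\<^sub>m 16)"
  have dim: "dim_row ?G = 16" "dim_col ?G = 32"
    using D16_carrier by (auto simp: hconcat_mat_def)
  assume "mod_vec 4 x \<in> C32"
  then obtain u where u: "u \<in> carrier_vec 16" "mod_vec 4 x = mod_vec 4 (?G\<^sup>T *\<^sub>v u)"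
    unfolding C32_def code_generated_by_def dim by blast
  have *: "[x $ j = (if j < 16 then u $ j else (\<Sum>i<16. u $ i * E_entry i (j - 16)))] (mod 4)"
    if "j < 32" for j
  proof -
    have "mod_vec 4 x $ j = mod_vec 4 (?G\<^sup>T *\<^sub>v u) $ j" using u by simp
    then have "x $ j mod 4 = (?G\<^sup>T *\<^sub>v u) $ j mod 4"
      using that x dim by (simp add: mod_vec_def)
    then show ?thesis unfolding cong_def generator_combination_index[OF u(1) that] .
  qed
  have xu: "[x $ i = u $ i] (mod 4)" if "i < 16" for i
    using *[of i] that by simp
  show "codeword (\<lambda>i. x $ i)"
    unfolding codeword_def
  proof (intro allI impI)
    fix j :: nat
    assume j: "j < 16"
    have "[x $ (16 + j) = (\<Sum>i<16. u $ i * E_entry i j)] (mod 4)"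
      using *[of "16 + j"] j by simp
    also have "[(\<Sum>i<16. u $ i * E_entry i j) = (\<Sum>i<16. x $ i * E_entry i j)] (mod 4)"
      using xu by (intro cong_sum cong_mult) (auto intro: cong_sym)
    finally show "[x $ (16 + j) = (\<Sum>i<16. x $ i * E_entry i j)] (mod 4)" .
  qed
next
  let ?G = "hconcat_mat (1\<^sub>m 16) (D16 + 2 \<cdot>\<^sub>m 1\<^sub>m 16)"
  have dim: "dim_row ?G = 16" "dim_col ?G = 32"
    using D16_carrier by (auto simp: hconcat_mat_def)
  assume cw: "codeword (\<lambda>i. x $ i)"
  define u where "u = vec 16 (\<lambda>i. x $ i)"
  have u: "u \<in> carrier_vec 16" unfolding u_def by simp
  have "mod_vec 4 x = mod_vec 4 (?G\<^sup>T *\<^sub>v u)"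
  proof (rule eq_vecI)
    show "dim_vec (mod_vec 4 x) = dim_vec (mod_vec 4 (?G\<^sup>T *\<^sub>v u))"
      using x dim by (simp add: mod_vec_def)
    fix j assume "j < dim_vec (mod_vec 4 (?G\<^sup>T *\<^sub>v u))"
    then have j: "j < 32" using dim by (simp add: mod_vec_def)
    have "x $ j mod 4 = (?G\<^sup>T *\<^sub>v u) $ j mod 4"
    proof (cases "j < 16")
      case True
      then show ?thesis unfolding generator_combination_index[OF u j] by (simp add: u_def)
    next
      case False
      then obtain l where l: "j = 16 + l" using le_Suc_ex not_less by blast
      then show ?thesis
        using cw j unfolding generator_combination_index[OF u j] codeword_def cong_def
        by (simp add: u_def)
    qed
    then show "mod_vec 4 x $ j = mod_vec 4 (?G\<^sup>T *\<^sub>v u) $ j"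
      using x j dim by (simp add: mod_vec_def)
  qed
  then show "mod_vec 4 x \<in> C32"
    using u unfolding C32_def code_generated_by_def dim by blast
qed

lemma mem_L32_iff:
  "v \<in> L32 \<longleftrightarrow> (\<exists>x\<in>carrier_vec 32. v = (1 / 2) \<cdot>\<^sub>v map_vec real_of_int x \<and> codeword (\<lambda>i. x $ i))"
  unfolding L32_def construction_A_def using mod_vec_in_C32_iff by auto

lemma codeword_cong:
  assumes "codeword x" "\<And>i. i < 32 \<Longrightarrow> [x i = y i] (mod 4)"
  shows "codeword y"
  unfolding codeword_def
proof (intro allI impI)
  fix j :: nat assume j: "j < 16"
  have "[y (16 + j) = x (16 + j)] (mod 4)" using assms(2)[of "16 + j"] j by (simp add: cong_sym)
  also have "[x (16 + j) = (\<Sum>i<16. x i * E_entry i j)] (mod 4)"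
    using assms(1) j by (simp add: codeword_def)
  also have "[(\<Sum>i<16. x i * E_entry i j) = (\<Sum>i<16. y i * E_entry i j)] (mod 4)"
    using assms(2) by (intro cong_sum cong_mult) auto
  finally show "[y (16 + j) = (\<Sum>i<16. y i * E_entry i j)] (mod 4)" .
qed

lemma codeword_add:
  assumes "codeword x" "codeword y"
  shows "codeword (\<lambda>i. x i + y i)"
  using assms unfolding codeword_def by (simp add: distrib_right sum.distrib cong_add)

lemma codeword_scale:
  assumes "codeword x"
  shows "codeword (\<lambda>i. c * x i)"
  using assms unfolding codeword_def
  by (simp add: mult.assoc cong_scalar_left flip: sum_distrib_left)

section \<open>Frames as integer matrices\<close>

definition code_frame :: "nat \<Rightarrow> (nat \<Rightarrow> nat \<Rightarrow> int) \<Rightarrow> bool" where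
  "code_frame k X \<longleftrightarrow> (\<forall>i<32. codeword (X i)) \<and>
     (\<forall>i<32. \<forall>j<32. (\<Sum>l<32. X i l * X j l) = (if i = j then 4 * int k else 0))"

lemma half_scalar_prod:
  assumes "x \<in> carrier_vec n" "y \<in> carrier_vec n"
  shows "((1 / 2) \<cdot>\<^sub>v map_vec real_of_int x) \<bullet> ((1 / 2) \<cdot>\<^sub>v map_vec real_of_int y)
    = real_of_int (\<Sum>l<n. x $ l * y $ l) / 4"
  using assms by (auto simp: scalar_prod_def lessThan_atLeast0 sum_divide_distrib intro!: sum.cong)

lemma code_frame_contains_frame:
  assumes "code_frame k X"
  shows "contains_frame 32 k L32"
proof -
  define v where "v i = vec 32 (X i)" for i
  define f where "f i = (1 / 2) \<cdot>\<^sub>v map_vec real_of_int (v i)" for i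
  have v: "v i \<in> carrier_vec 32" for i unfolding v_def by simp
  have "f i \<in> L32" if "i < 32" for i
  proof -
    have "codeword (\<lambda>l. v i $ l)"
      using assms that unfolding code_frame_def v_def by (auto intro: codeword_cong)
    then show ?thesis unfolding mem_L32_iff f_def using v by blast
  qed
  moreover have "f i \<bullet> f j = (if i = j then real k else 0)" if "i < 32" "j < 32" for i j
    using assms that unfolding f_def half_scalar_prod[OF v v] code_frame_def by (simp add: v_def)
  ultimately show ?thesis unfolding contains_frame_def is_frame_def by blast
qed

text \<open>A single frame vector carries the lower bound on \<open>k\<close>.\<close>

lemma frame_codeword:
  assumes "contains_frame 32 k L32"
  obtains x where "codeword x" "(\<Sum>l<32. (x l)^2) = 4 * int k"
proof -
  obtain f where "f 0 \<in> L32" "f 0 \<bullet> f 0 = real k"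
    using assms unfolding contains_frame_def is_frame_def by fastforce
  then obtain x where x: "x \<in> carrier_vec 32" "codeword (\<lambda>l. x $ l)"
    "real_of_int (\<Sum>l<32. x $ l * x $ l) / 4 = real k"
    unfolding mem_L32_iff using half_scalar_prod by metis
  then have "real_of_int (\<Sum>l<32. x $ l * x $ l) = real_of_int (4 * int k)" by simp
  then have "(\<Sum>l<32. x $ l * x $ l) = 4 * int k" by (simp only: of_int_eq_iff)
  then show thesis using that[of "\<lambda>l. x $ l"] x by (simp add: power2_eq_square)
qed

lemma code_frame_double:
  assumes "code_frame k X"
  shows "\<exists>Y. code_frame (2 * k) Y"
proof -
  define Y where "Y i = (if even i then (\<lambda>l. X i l + X (Suc i) l) else (\<lambda>l. X (i - 1) l + (-1) * X i l))" for i
  have cw: "codeword (X i)" if "i < 32" for i using assms that unfolding code_frame_def by blast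
  have dot: "(\<Sum>l<32. X i l * X j l) = (if i = j then 4 * int k else 0)" if "i < 32" "j < 32" for i j
    using assms that unfolding code_frame_def by blast
  have Suc_less: "Suc i < 32" if "even i" "i < 32" for i :: nat
    using that by (cases "i = 31") auto
  have "codeword (Y i)" if i: "i < 32" for i
  proof (cases "even i")
    case True
    then show ?thesis using codeword_add[OF cw cw] Suc_less i by (simp add: Y_def)
  next
    case False
    have "i - 1 < 32" using i by simp
    from codeword_add[OF cw[OF this] codeword_scale[OF cw[OF i], of "-1"]]
    show ?thesis using False by (simp add: Y_def)
  qed
  moreover have "(\<Sum>l<32. Y i l * Y j l) = (if i = j then 4 * int (2 * k) else 0)"
    if ij: "i < 32" "j < 32" for i j
  proof -
    \<comment> \<open>The sign \<open>s\<close> covers both parities in one expansion: within a pair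
      the product is \<open>4 * k * (1 + s * t)\<close>, that is \<open>8 * k\<close> or 0.\<close>
    have form: "\<exists>a s. Y i = (\<lambda>l. X (2 * a) l + s * X (Suc (2 * a)) l) \<and> Suc (2 * a) < 32
        \<and> (i = 2 * a \<and> s = 1 \<or> i = Suc (2 * a) \<and> s = -1)" if "i < 32" for i
    proof (cases "even i")
      case True
      then obtain a where "i = 2 * a" by blast
      then show ?thesis using that Suc_less[OF True that] by (intro exI[of _ a] exI[of _ 1]) (simp add: Y_def)
    next
      case False
      then obtain a where "i = Suc (2 * a)" using oddE by fastforce
      then show ?thesis using that by (intro exI[of _ a] exI[of _ "-1"]) (simp add: Y_def)
    qed
    obtain a s where i: "Y i = (\<lambda>l. X (2 * a) l + s * X (Suc (2 * a)) l)" "Suc (2 * a) < 32"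
        "i = 2 * a \<and> s = 1 \<or> i = Suc (2 * a) \<and> s = -1"
      using form[OF ij(1)] by blast
    obtain b t where j: "Y j = (\<lambda>l. X (2 * b) l + t * X (Suc (2 * b)) l)" "Suc (2 * b) < 32"
        "j = 2 * b \<and> t = 1 \<or> j = Suc (2 * b) \<and> t = -1"
      using form[OF ij(2)] by blast
    have "(\<Sum>l<32. Y i l * Y j l) = (\<Sum>l<32. X (2*a) l * X (2*b) l)
      + t * (\<Sum>l<32. X (2*a) l * X (Suc (2*b)) l) + s * (\<Sum>l<32. X (Suc (2*a)) l * X (2*b) l)
      + s * t * (\<Sum>l<32. X (Suc (2*a)) l * X (Suc (2*b)) l)"
      unfolding i(1) j(1) sum_distrib_left sum.distrib[symmetric]
      by (intro sum.cong) (simp_all add: algebra_simps)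
    also have "\<dots> = (if i = j then 4 * int (2 * k) else 0)"
    proof -
      have "2 * a \<noteq> Suc (2 * b)" "Suc (2 * a) \<noteq> 2 * b" by presburger+
      then show ?thesis using i(2,3) j(2,3) by (auto simp: dot)
    qed
    finally show ?thesis .
  qed
  ultimately show ?thesis unfolding code_frame_def by blast
qed



section \<open>A quaternionic family of frames\<close>

text \<open>Accumulating one row at a time evaluates on concrete lists and follows the same
  recursion as \<open>light_sums_heavy\<close>.\<close>

fun row_combination :: "int list \<Rightarrow> int list list \<Rightarrow> int list \<Rightarrow> int list" where
  "row_combination (a # u) (r # rs) acc = row_combination u rs (map2 (\<lambda>x y. x + a * y) acc r)"
| "row_combination _ _ acc = acc"

lemma row_combination_nth:
  assumes "length u = length rs" "\<And>r. r \<in> set rs \<Longrightarrow> length r = length acc" "j < length acc"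
  shows "length (row_combination u rs acc) = length acc"
    "row_combination u rs acc ! j = acc ! j + (\<Sum>i<length u. u ! i * rs ! i ! j)"
  using assms
proof (induction u rs acc rule: row_combination.induct)
  case (1 a u r rs acc)
  {
    case 1 then show ?case using "1.IH" by simp
  next
    case 2 then show ?case using "1.IH" by (simp add: sum.lessThan_Suc_shift del: sum.lessThan_Suc)
  }
qed simp_all

lemma E_rows_length: "length E_rows = 16" "r \<in> set E_rows \<Longrightarrow> length r = 16"
proof -
  have "length E_rows = 16 \<and> list_all (\<lambda>r. length r = 16) E_rows" by code_simp
  then show "length E_rows = 16" "r \<in> set E_rows \<Longrightarrow> length r = 16"
    by (auto simp: list_all_iff)
qed

definition times_E :: "int list \<Rightarrow> int list" where
  "times_E u = row_combination u E_rows (replicate 16 0)"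

lemma times_E_nth:
  assumes "length u = 16" "j < 16"
  shows "length (times_E u) = 16" "times_E u ! j = (\<Sum>i<16. u ! i * E_entry i j)"
  using row_combination_nth[of u E_rows "replicate 16 0" j] assms E_rows_length
  unfolding times_E_def by simp_all

definition codeword_list :: "int list \<Rightarrow> bool" where
  "codeword_list xs \<longleftrightarrow> length xs = 32
     \<and> map (\<lambda>a. a mod 4) (drop 16 xs) = map (\<lambda>a. a mod 4) (times_E (take 16 xs))"

lemma codeword_list_codeword:
  assumes "codeword_list xs"
  shows "codeword (\<lambda>i. xs ! i)"
  unfolding codeword_def cong_def
proof (intro allI impI)
  fix j :: nat assume j: "j < 16"
  have len: "length xs = 32" using assms unfolding codeword_list_def by simp
  have "map (\<lambda>a. a mod 4) (drop 16 xs) ! j = map (\<lambda>a. a mod 4) (times_E (take 16 xs)) ! j"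
    using assms unfolding codeword_list_def by simp
  then have "xs ! (16 + j) mod 4 = times_E (take 16 xs) ! j mod 4"
    using len j times_E_nth(1)[of "take 16 xs" j] by simp
  then show "xs ! (16 + j) mod 4 = (\<Sum>i<16. xs ! i * E_entry i j) mod 4"
    using len j times_E_nth(2)[of "take 16 xs" j] by simp
qed

fun dot :: "int list \<Rightarrow> int list \<Rightarrow> int" where
  "dot (a # xs) (b # ys) = a * b + dot xs ys"
| "dot _ _ = 0"

lemma dot_eq_sum: "length xs = length ys \<Longrightarrow> dot xs ys = (\<Sum>l<length ys. xs ! l * ys ! l)"
  by (induction xs ys rule: dot.induct) (simp_all add: sum.lessThan_Suc_shift del: sum.lessThan_Suc)

lemma dot_commute: "dot xs ys = dot ys xs"
  by (induction xs ys rule: dot.induct) simp_all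

fun orthogonal_rows :: "int \<Rightarrow> int list list \<Rightarrow> bool" where
  "orthogonal_rows c [] = True"
| "orthogonal_rows c (r # rs) \<longleftrightarrow> dot r r = c \<and> list_all (\<lambda>r'. dot r r' = 0) rs \<and> orthogonal_rows c rs"

lemma orthogonal_rows_nth:
  assumes "orthogonal_rows c rs" "i < length rs" "j < length rs"
  shows "dot (rs ! i) (rs ! j) = (if i = j then c else 0)"
  using assms
proof (induction rs arbitrary: i j)
  case (Cons r rs)
  then have 0: "dot r (rs ! l) = 0" "dot (rs ! l) r = 0" if "l < length rs" for l
    using that by (auto simp: list_all_iff dot_commute[of "rs ! l" r])
  from Cons show ?case
    by (cases i; cases j) (simp_all add: 0)
qed simp

lemma code_frame_of_rows:
  assumes "length rs = 32" "\<And>r. r \<in> set rs \<Longrightarrow> length r = 32"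
    "\<And>r. r \<in> set rs \<Longrightarrow> codeword (\<lambda>l. r ! l)" "orthogonal_rows (4 * int k) rs"
  shows "code_frame k (\<lambda>i l. rs ! i ! l)"
proof -
  have "(\<Sum>l<32. rs ! i ! l * rs ! j ! l) = (if i = j then 4 * int k else 0)"
    if "i < 32" "j < 32" for i j
    using orthogonal_rows_nth[OF assms(4)] dot_eq_sum[of "rs ! i" "rs ! j"] assms(1,2) that
    by simp
  then show ?thesis using assms unfolding code_frame_def by simp
qed

text \<open>The matrix \<open>s + x I + y J + z K\<close>. Let \<open>X\<close> be the negacyclic shift of both blocks of length 8 and
  \<open>R\<close> the involution of \<open>\<int>\<^sup>8\<close> with \<open>e\<^sub>0 \<mapsto> e\<^sub>0\<close> and \<open>e\<^sub>i \<mapsto> - e\<^bsub>8-i\<^esub>\<close>, which transposes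
  negacirculant matrices by conjugation. Then \<open>I = X^4\<close>, \<open>J = (0, R; -R, 0)\<close> and \<open>K = I J\<close>.\<close>

definition quaternion_rows :: "int \<Rightarrow> int \<Rightarrow> int \<Rightarrow> int \<Rightarrow> int list list" where
  "quaternion_rows s x y z = [[s, 0, 0, 0, x, 0, 0, 0, y, 0, 0, 0, -z, 0, 0, 0],
   [0, s, 0, 0, 0, x, 0, 0, 0, 0, 0, -z, 0, 0, 0, -y],
   [0, 0, s, 0, 0, 0, x, 0, 0, 0, -z, 0, 0, 0, -y, 0],
   [0, 0, 0, s, 0, 0, 0, x, 0, -z, 0, 0, 0, -y, 0, 0],
   [-x, 0, 0, 0, s, 0, 0, 0, -z, 0, 0, 0, -y, 0, 0, 0],
   [0, -x, 0, 0, 0, s, 0, 0, 0, 0, 0, -y, 0, 0, 0, z],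
   [0, 0, -x, 0, 0, 0, s, 0, 0, 0, -y, 0, 0, 0, z, 0],
   [0, 0, 0, -x, 0, 0, 0, s, 0, -y, 0, 0, 0, z, 0, 0],
   [-y, 0, 0, 0, z, 0, 0, 0, s, 0, 0, 0, x, 0, 0, 0],
   [0, 0, 0, z, 0, 0, 0, y, 0, s, 0, 0, 0, x, 0, 0],
   [0, 0, z, 0, 0, 0, y, 0, 0, 0, s, 0, 0, 0, x, 0],
   [0, z, 0, 0, 0, y, 0, 0, 0, 0, 0, s, 0, 0, 0, x],
   [z, 0, 0, 0, y, 0, 0, 0, -x, 0, 0, 0, s, 0, 0, 0],
   [0, 0, 0, y, 0, 0, 0, -z, 0, -x, 0, 0, 0, s, 0, 0],
   [0, 0, y, 0, 0, 0, -z, 0, 0, 0, -x, 0, 0, 0, s, 0],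
   [0, y, 0, 0, 0, -z, 0, 0, 0, 0, 0, -x, 0, 0, 0, s]]"

text \<open>Negating \<open>x\<close>, \<open>y\<close>, \<open>z\<close> transposes the quaternion
  block, since the three units are skew-symmetric.\<close>

definition frame_rows :: "int \<Rightarrow> int \<Rightarrow> int \<Rightarrow> int \<Rightarrow> int \<Rightarrow> int \<Rightarrow> int list list" where
  "frame_rows s x y z v w = map2 (@) (quaternion_rows s x y z) (D_shift v w)
     @ map2 (@) (D_shift (- v) w) (quaternion_rows s (- x) (- y) (- z))"

lemma upt_16: "[0..<16] = [0, 1, 2, 3, 4, 5, 6, 7, 8, 9, 10, 11, 12, 13, 14, 15]"
  by (simp add: upt_rec)

lemma D_shift_explicit:
  "D_shift v w = map2 (\<lambda>i r. (map ((*) w) r)[i := v]) [0, 1, 2, 3, 4, 5, 6, 7, 8, 9, 10, 11, 12, 13, 14, 15] D_rows"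
  unfolding D_shift_def upt_16 ..

text \<open>Off-diagonal blocks vanish because \<open>q\<close> commutes with \<open>D\<close>; in
  the diagonal ones the terms in \<open>v * w\<close> cancel by skewness, and
  \<open>D D^T = 15\<close>. The check is a polynomial identity for each pair of rows.\<close>

lemma frame_rows_orthogonal:
  "orthogonal_rows (s^2 + x^2 + y^2 + z^2 + v^2 + 15 * w^2) (frame_rows s x y z v w)"
  unfolding frame_rows_def D_shift_explicit D_rows_def quaternion_rows_def
  by (simp add: power2_eq_square algebra_simps)

lemma frame_rows_length:
  "length (frame_rows s x y z v w) = 32" "r \<in> set (frame_rows s x y z v w) \<Longrightarrow> length r = 32"
proof -
  have "length (frame_rows s x y z v w) = 32 \<and> list_all (\<lambda>r. length r = 32) (frame_rows s x y z v w)"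
    unfolding frame_rows_def D_shift_explicit D_rows_def quaternion_rows_def by simp
  then show "length (frame_rows s x y z v w) = 32"
    "r \<in> set (frame_rows s x y z v w) \<Longrightarrow> length r = 32"
    by (auto simp: list_all_iff)
qed

text \<open>The upper rows \<open>(I, E)\<close> are the generators; the lower ones are
  \<open>(D - 2, I)\<close>, where \<open>D - 2\<close> is congruent to \<open>E\<close> and
  \<open>E^2\<close> to 1 modulo 4.\<close>

lemma frame_rows_base_codeword: "list_all codeword_list (frame_rows 1 0 0 0 2 1)"
  by code_simp

text \<open>Modulo 4 the whole family consists of multiples of one matrix, so a single evaluated
  instance settles membership in the code.\<close>

lemma frame_rows_cong:
  "list_all2 (list_all2 (\<lambda>a b. 4 dvd a - w * b))
     (frame_rows (w + 4 * s) (4 * x) (4 * y) (4 * z) (2 * w + 4 * v) w) (frame_rows 1 0 0 0 2 1)"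
  unfolding frame_rows_def D_shift_explicit D_rows_def quaternion_rows_def by simp

lemma code_frame_family:
  assumes "4 * int k = (w + 4 * s)^2 + (4 * x)^2 + (4 * y)^2 + (4 * z)^2 + (2 * w + 4 * v)^2 + 15 * w^2"
  shows "\<exists>X. code_frame k X"
proof -
  let ?F = "frame_rows (w + 4 * s) (4 * x) (4 * y) (4 * z) (2 * w + 4 * v) w"
  have "codeword (\<lambda>l. r ! l)" if "r \<in> set ?F" for r
  proof -
    obtain i where i: "i < 32" "r = ?F ! i"
      using \<open>r \<in> set ?F\<close> frame_rows_length(1) by (metis in_set_conv_nth)
    define b where "b = frame_rows 1 0 0 0 2 1 ! i"
    have b: "b \<in> set (frame_rows 1 0 0 0 2 1)"
      unfolding b_def using i frame_rows_length(1) by (metis nth_mem)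
    then have "codeword (\<lambda>l. b ! l)"
      using frame_rows_base_codeword codeword_list_codeword by (auto simp: list_all_iff)
    then have wb: "codeword (\<lambda>l. w * b ! l)" by (rule codeword_scale)
    have "list_all2 (\<lambda>a b. 4 dvd a - w * b) r b"
      using list_all2_nthD[OF frame_rows_cong, of i w s x y z v] i frame_rows_length(1) unfolding b_def by simp
    then have "4 dvd r ! l - w * b ! l" if "l < 32" for l
      using list_all2_nthD[of _ r b l] frame_rows_length(2)[OF b] list_all2_lengthD that by fastforce
    then have "[w * b ! l = r ! l] (mod 4)" if "l < 32" for l
      using that by (metis cong_iff_dvd_diff cong_sym)
    then show ?thesis using codeword_cong[OF wb] by blast
  qed
  then show ?thesis
    using code_frame_of_rows[of ?F k] frame_rows_orthogonal frame_rows_length assms by metis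
qed



section \<open>Frames for all norms from 4 on\<close>

text \<open>The 6-frame, found by computer, consists of the images of two codewords under the group of
  order 32 generated by \<open>X\<close> and \<open>J\<close> (modulo signs).\<close>

definition negashift :: "int list \<Rightarrow> int list" where
  "negashift a = - last a # butlast a"

definition negareverse :: "int list \<Rightarrow> int list" where
  "negareverse a = hd a # map uminus (rev (tl a))"

definition shift :: "int list \<Rightarrow> int list" where
  "shift u = negashift (take 8 u) @ negashift (drop 8 u)"

definition twist :: "int list \<Rightarrow> int list" where
  "twist u = map uminus (negareverse (drop 8 u)) @ negareverse (take 8 u)"

fun iterates :: "nat \<Rightarrow> int list \<Rightarrow> int list list" where
  "iterates 0 u = []"
| "iterates (Suc n) u = u # iterates n (shift u)"

text \<open>Since \<open>X^8 = -1\<close>, eight shifts exhaust the powers of \<open>X\<close> up to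
  sign; with \<open>twist\<close> for \<open>J\<close> this gives 16 vectors.\<close>

definition orbit :: "int list \<Rightarrow> int list list" where
  "orbit u = iterates 8 u @ iterates 8 (twist u)"

text \<open>The halves are eigenvectors of \<open>E\<close> modulo 4, of norm 12, for the
  eigenvalues -1 and 1. Rows from different orbits are orthogonal by their shapes
  \<open>(u, -u)\<close> and \<open>(u, u)\<close>.\<close>

definition six_frame_rows :: "int list list" where
  "six_frame_rows =
     map (\<lambda>u. u @ map uminus u) (orbit [1, -1, 1, 1, 0, 1, 1, 0, -1, 0, -1, 1, 1, 1, 0, -1])
     @ map (\<lambda>u. u @ u) (orbit [-1, -1, 0, 1, 0, 1, 0, 1, -1, 1, 0, -1, -1, 1, 1, -1])"

lemma code_frame_6: "\<exists>X. code_frame 6 X"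
proof -
  have "length six_frame_rows = 32 \<and> list_all (\<lambda>r. length r = 32) six_frame_rows
      \<and> list_all codeword_list six_frame_rows \<and> orthogonal_rows 24 six_frame_rows"
    by code_simp
  then show ?thesis
    using code_frame_of_rows[of six_frame_rows 6] codeword_list_codeword
    by (auto simp: list_all_iff)
qed

lemma sum4sq_one_odd:
  fixes n :: nat
  assumes "n mod 4 = 1"
  obtains t x y z :: int where "int n = (1 + 2 * t)^2 + 4 * (x^2 + y^2 + z^2)"
proof -
  have sq: "a^2 mod 4 = (if even a then 0 else 1)" for a :: int
  proof (cases "even a")
    case True
    then show ?thesis by (auto elim!: evenE simp: power_mult_distrib)
  next
    case False
    then obtain b where "a = 2 * b + 1" by (elim oddE)
    then have "a^2 = 4 * (b^2 + b) + 1" by (simp add: power2_eq_square algebra_simps)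
    then have "a^2 mod 4 = 1 mod 4" by (simp only: mod_mult_self4)
    then show ?thesis using False by simp
  qed
  note witness = that
  have goal: thesis if h: "int n = a^2 + b^2 + c^2 + d^2" "odd a" "even b" "even c" "even d" for a b c d
  proof -
    obtain t where "a = 1 + 2 * t" using h(2) by (metis add.commute oddE)
    moreover obtain x y z where "b = 2 * x" "c = 2 * y" "d = 2 * z" using h(3-5) by (elim evenE)
    ultimately show thesis using h(1) by (intro witness[of t x y z]) (simp add: power_mult_distrib)
  qed
  obtain a b c d where *: "int n = a^2 + b^2 + c^2 + d^2"
    using lagrange_four_squares[of n] unfolding sum4sq_def by blast
  have "(a^2 + b^2 + c^2 + d^2) mod 4 = 1" using assms * by (metis of_nat_1 of_nat_mod of_nat_numeral)
  moreover have "[a^2 mod 4 + b^2 mod 4 + c^2 mod 4 + d^2 mod 4 = a^2 + b^2 + c^2 + d^2] (mod 4)"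
    by (intro cong_add) (simp_all add: cong_def)
  ultimately have "(a^2 mod 4 + b^2 mod 4 + c^2 mod 4 + d^2 mod 4) mod 4 = 1"
    by (simp add: cong_def)
  \<comment> \<open>Squares are 0 or 1 modulo 4, so the number of odd terms, at most four, is
    congruent to 1 and hence equal to 1.\<close>
  then consider "odd a" "even b" "even c" "even d" | "odd b" "even a" "even c" "even d"
    | "odd c" "even a" "even b" "even d" | "odd d" "even a" "even b" "even c"
    unfolding sq by (auto split: if_splits)
  then show thesis
    using goal[of a b c d] goal[of b a c d] goal[of c a b d] goal[of d a b c] * by cases simp_all
qed

lemma code_frame_odd:
  assumes "odd k" "k \<ge> 5"
  shows "\<exists>X. code_frame k X"
proof -
  \<comment> \<open>For \<open>w = 1\<close> the norm formula divided by 4 reads \<open>k = ((1 + 4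
    * s)^2 + 15) / 4 + (1 + 2 * t)^2 + 4 * (x^2 + y^2 + z^2)\<close>. Its first term is 4 for
    \<open>s = 0\<close> and 6 for \<open>s = -1\<close>; the choice makes \<open>k - m\<close>
    congruent to 1 modulo 4.\<close>
  define m :: nat where "m = (if k mod 4 = 1 then 4 else 6)"
  have k: "k mod 4 = 1 \<or> k mod 4 = 3" using \<open>odd k\<close> by presburger
  have "m \<le> k \<and> (k - m) mod 4 = 1"
  proof (cases "k mod 4 = 1")
    case True
    then have "k = 4 * (k div 4) + 1" by presburger
    then obtain q where "k = 4 * q + 1" by blast
    then show ?thesis using assms(2) True by (cases q) (simp_all add: m_def)
  next
    case False
    then have "k = 4 * (k div 4) + 3" using k by presburger
    then obtain q where "k = 4 * q + 3" by blast
    then show ?thesis using assms(2) False by (cases q) (simp_all add: m_def)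
  qed
  moreover from this obtain t x y z :: int where "int (k - m) = (1 + 2 * t)^2 + 4 * (x^2 + y^2 + z^2)"
    using sum4sq_one_odd by blast
  ultimately have n: "int k = int m + (1 + 2 * t)^2 + 4 * (x^2 + y^2 + z^2)" by linarith
  define s :: int where "s = (if k mod 4 = 1 then 0 else -1)"
  have "(1 + 4 * s)^2 = 4 * int m - 15" unfolding s_def m_def by simp
  then have "4 * int k = (1 + 4 * s)^2 + (4 * x)^2 + (4 * y)^2 + (4 * z)^2 + (2 * 1 + 4 * t)^2 + 15 * 1^2"
    unfolding n by (simp add: power2_eq_square algebra_simps)
  then show ?thesis by (rule code_frame_family)
qed

lemma code_frame_exists:
  assumes "k \<ge> 4"
  shows "\<exists>X. code_frame k X"
proof -
  consider "odd k" | q where "k = 4 * q" | q where "k = 2 * q" "odd q"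
    by (metis evenE mult.assoc mult_2_right numeral_Bit0 mult_2)
  then show ?thesis
  proof cases
    case 1
    then have "k \<ge> 5" using assms by (cases "k = 4") auto
    then show ?thesis using 1 code_frame_odd by blast
  next
    case 2
    obtain a b c d where "int q = a^2 + b^2 + c^2 + d^2"
      using lagrange_four_squares[of q] unfolding sum4sq_def by blast
    then have "4 * int k = (0 + 4 * a)^2 + (4 * b)^2 + (4 * c)^2 + (4 * d)^2 + (2 * 0 + 4 * 0)^2 + 15 * 0^2"
      using 2 by (simp add: power_mult_distrib)
    then show ?thesis by (rule code_frame_family)
  next
    case 3
    show ?thesis
    proof (cases "q = 3")
      case True
      then show ?thesis using 3 code_frame_6 by simp
    next
      case False
      then have "q \<ge> 5" using 3 assms by presburger
      then show ?thesis using 3 code_frame_odd code_frame_double by blast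
    qed
  qed
qed



section \<open>The minimum norm\<close>

text \<open>The enumeration meets about 174000 residue vectors; constructors turn each addition into
  pattern matching instead of integer arithmetic.\<close>

datatype z4 = Z0 | Z1 | Z2 | Z3

fun z4_add :: "z4 \<Rightarrow> z4 \<Rightarrow> z4" where
  "z4_add Z0 b = b"
| "z4_add Z1 Z0 = Z1" | "z4_add Z1 Z1 = Z2" | "z4_add Z1 Z2 = Z3" | "z4_add Z1 Z3 = Z0"
| "z4_add Z2 Z0 = Z2" | "z4_add Z2 Z1 = Z3" | "z4_add Z2 Z2 = Z0" | "z4_add Z2 Z3 = Z1"
| "z4_add Z3 Z0 = Z3" | "z4_add Z3 Z1 = Z0" | "z4_add Z3 Z2 = Z1" | "z4_add Z3 Z3 = Z2"

fun z4_sub :: "z4 \<Rightarrow> z4 \<Rightarrow> z4" where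
  "z4_sub a Z0 = a"
| "z4_sub Z0 Z1 = Z3" | "z4_sub Z1 Z1 = Z0" | "z4_sub Z2 Z1 = Z1" | "z4_sub Z3 Z1 = Z2"
| "z4_sub Z0 Z2 = Z2" | "z4_sub Z1 Z2 = Z3" | "z4_sub Z2 Z2 = Z0" | "z4_sub Z3 Z2 = Z1"
| "z4_sub Z0 Z3 = Z1" | "z4_sub Z1 Z3 = Z2" | "z4_sub Z2 Z3 = Z3" | "z4_sub Z3 Z3 = Z0"

fun row_add :: "z4 list \<Rightarrow> z4 list \<Rightarrow> z4 list" where
  "row_add (a # r) (b # r') = z4_add a b # row_add r r'"
| "row_add _ _ = []"

fun row_sub :: "z4 list \<Rightarrow> z4 list \<Rightarrow> z4 list" where
  "row_sub (a # r) (b # r') = z4_sub a b # row_sub r r'"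
| "row_sub _ _ = []"

fun pred4 :: "nat \<Rightarrow> nat" where
  "pred4 (Suc (Suc (Suc (Suc n)))) = n"
| "pred4 _ = 0"

text \<open>Whether the minimal squared norm of an integer lift is at least \<open>n\<close>.\<close>

fun heavy :: "nat \<Rightarrow> z4 list \<Rightarrow> bool" where
  "heavy 0 _ = True"
| "heavy (Suc n) [] = False"
| "heavy (Suc n) (Z0 # r) = heavy (Suc n) r"
| "heavy (Suc n) (Z1 # r) = heavy n r"
| "heavy (Suc n) (Z2 # r) = heavy (pred4 (Suc n)) r"
| "heavy (Suc n) (Z3 # r) = heavy n r"

text \<open>\<open>light_sums_heavy rs k acc\<close> runs over all \<open>u\<close> of minimal squared norm at most \<open>k\<close> and checks that
  \<open>acc + u rs\<close> has norm at least \<open>11 + k'\<close>, where \<open>k'\<close> is what \<open>u\<close> leaves of the budget \<open>k\<close>. Starting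
  with \<open>k = 5\<close>, the norms of \<open>u\<close> and \<open>u rs\<close> then add up to at least 16; the exception \<open>k' = 5\<close> is
  the case \<open>u = 0\<close>.\<close>

fun light_sums_heavy :: "z4 list list \<Rightarrow> nat \<Rightarrow> z4 list \<Rightarrow> bool" where
  "light_sums_heavy rs 0 acc = heavy 11 acc"
| "light_sums_heavy [] (Suc k) acc = (k = 4 \<or> heavy (12 + k) acc)"
| "light_sums_heavy (r # rs) (Suc k) acc \<longleftrightarrow> light_sums_heavy rs (Suc k) acc
     \<and> light_sums_heavy rs k (row_add acc r) \<and> light_sums_heavy rs k (row_sub acc r)
     \<and> (k < 3 \<or> light_sums_heavy rs (k - 3) (row_add acc (row_add r r)))"

definition to_z4 :: "int \<Rightarrow> z4" where
  "to_z4 a = (if a mod 4 = 0 then Z0 else if a mod 4 = 1 then Z1 else if a mod 4 = 2 then Z2 else Z3)"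


definition min_square :: "int \<Rightarrow> nat" where
  "min_square a = (if a mod 4 = 0 then 0 else if a mod 4 = 2 then 4 else 1)"

lemma mod4_cases:
  fixes a :: int
  obtains "a mod 4 = 0" | "a mod 4 = 1" | "a mod 4 = 2" | "a mod 4 = 3"
proof -
  have "a mod 4 = 0 \<or> a mod 4 = 1 \<or> a mod 4 = 2 \<or> a mod 4 = 3" by presburger
  then show thesis by (elim disjE) (fact that)+
qed

lemma min_square_le: "int (min_square a) \<le> a^2"
proof -
  have "4 \<le> a^2" if "a mod 4 = 2"
  proof -
    have "2 \<le> \<bar>a\<bar>" using that by presburger
    then show ?thesis using power_mono[of 2 "\<bar>a\<bar>" 2] by simp
  qed
  moreover have "1 \<le> a^2" if "a mod 4 \<noteq> 0"
  proof -
    have "a \<noteq> 0" using that by auto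
    then show ?thesis by (simp add: int_one_le_iff_zero_less)
  qed
  ultimately show ?thesis by (simp add: min_square_def)
qed

lemma to_z4_cong: "[a = b] (mod 4) \<Longrightarrow> to_z4 a = to_z4 b"
  unfolding to_z4_def cong_def by simp

lemma z4_add_to_z4: "z4_add (to_z4 a) (to_z4 b) = to_z4 (a + b)"
proof -
  have "(a + b) mod 4 = (a mod 4 + b mod 4) mod 4" by presburger
  then show ?thesis
    by (cases a rule: mod4_cases; cases b rule: mod4_cases) (simp_all add: to_z4_def)
qed

lemma z4_sub_to_z4: "z4_sub (to_z4 a) (to_z4 b) = to_z4 (a - b)"
proof -
  have "(a - b) mod 4 = (a mod 4 - b mod 4) mod 4" by presburger
  then show ?thesis
    by (cases a rule: mod4_cases; cases b rule: mod4_cases) (simp_all add: to_z4_def)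
qed

lemma row_add_to_z4: "row_add (map to_z4 xs) (map to_z4 ys) = map to_z4 (map2 (+) xs ys)"
  by (induction xs ys rule: list_induct2') (simp_all add: z4_add_to_z4)

lemma row_sub_to_z4: "row_sub (map to_z4 xs) (map to_z4 ys) = map to_z4 (map2 (-) xs ys)"
  by (induction xs ys rule: list_induct2') (simp_all add: z4_sub_to_z4)

lemma cong_add_multiple:
  fixes a b x y :: int
  assumes "[a = b] (mod 4)"
  shows "to_z4 (x + a * y) = to_z4 (x + b * y)"
  using assms by (intro to_z4_cong cong_add cong_mult) auto

text \<open>One case for each branch of \<open>light_sums_heavy\<close>.\<close>

lemma add_multiple_to_z4:
  assumes "length xs = length ys"
  shows "a mod 4 = 0 \<Longrightarrow> map to_z4 (map2 (\<lambda>x y. x + a * y) xs ys) = map to_z4 xs"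
    "a mod 4 = 1 \<Longrightarrow> map to_z4 (map2 (\<lambda>x y. x + a * y) xs ys) = row_add (map to_z4 xs) (map to_z4 ys)"
    "a mod 4 = 2 \<Longrightarrow> map to_z4 (map2 (\<lambda>x y. x + a * y) xs ys)
      = row_add (map to_z4 xs) (row_add (map to_z4 ys) (map to_z4 ys))"
    "a mod 4 = 3 \<Longrightarrow> map to_z4 (map2 (\<lambda>x y. x + a * y) xs ys) = row_sub (map to_z4 xs) (map to_z4 ys)"
proof -
  have c: "to_z4 (x + a * y) = to_z4 (x + b * y)" if "a mod 4 = b mod 4" for x y b
    using that by (intro cong_add_multiple) (simp add: cong_def)
  show "map to_z4 (map2 (\<lambda>x y. x + a * y) xs ys) = map to_z4 xs" if "a mod 4 = 0"
    using assms c[of 0] that by (induction xs ys rule: list_induct2) simp_all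
  show "map to_z4 (map2 (\<lambda>x y. x + a * y) xs ys) = row_add (map to_z4 xs) (map to_z4 ys)" if "a mod 4 = 1"
    using assms c[of 1] that by (induction xs ys rule: list_induct2) (simp_all add: z4_add_to_z4)
  show "map to_z4 (map2 (\<lambda>x y. x + a * y) xs ys)
      = row_add (map to_z4 xs) (row_add (map to_z4 ys) (map to_z4 ys))" if "a mod 4 = 2"
    using assms c[of 2] that by (induction xs ys rule: list_induct2) (simp_all add: z4_add_to_z4)
  show "map to_z4 (map2 (\<lambda>x y. x + a * y) xs ys) = row_sub (map to_z4 xs) (map to_z4 ys)" if "a mod 4 = 3"
    using assms c[of "-1"] that by (induction xs ys rule: list_induct2) (simp_all add: z4_sub_to_z4)
qed

lemma heavy_min_square:
  "heavy n (map to_z4 xs) \<Longrightarrow> n \<le> (\<Sum>a\<leftarrow>xs. min_square a)"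
proof (induction xs arbitrary: n)
  case Nil
  then show ?case by (cases n) simp_all
next
  case (Cons a xs)
  show ?case
  proof (cases n)
    case (Suc m)
    \<comment> \<open>\<open>pred4\<close> truncates at 0, hence only an inequality.\<close>
    have "Suc m \<le> pred4 (Suc m) + 4"
      by (cases "Suc m" rule: pred4.cases) simp_all
    then show ?thesis
      using Cons.prems Cons.IH[of "Suc m"] Cons.IH[of m] Cons.IH[of "pred4 (Suc m)"] Suc
      by (cases a rule: mod4_cases) (simp_all add: to_z4_def min_square_def)
  qed simp
qed

text \<open>Justifies stopping at budget 0: all remaining coefficients vanish modulo 4.\<close>

lemma row_combination_to_z4_0:
  assumes "length u = length rs" "\<And>r. r \<in> set rs \<Longrightarrow> length r = length acc"
    "(\<Sum>a\<leftarrow>u. min_square a) = 0"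
  shows "map to_z4 (row_combination u rs acc) = map to_z4 acc"
  using assms
proof (induction u rs acc rule: row_combination.induct)
  case (1 a u r rs acc)
  have "a mod 4 = 0" using "1.prems"(3) by (cases a rule: mod4_cases) (simp_all add: min_square_def)
  then show ?case using "1.IH" "1.prems" by (simp add: add_multiple_to_z4(1) del: map_map)
qed simp_all

lemma light_sums_heavy_sound:
  assumes "light_sums_heavy (map (map to_z4) rs) k (map to_z4 acc)"
    "length u = length rs" "\<And>r. r \<in> set rs \<Longrightarrow> length r = length acc"
    "(\<Sum>a\<leftarrow>u. min_square a) \<le> k"
  shows "k - (\<Sum>a\<leftarrow>u. min_square a) = 5
    \<or> heavy (11 + (k - (\<Sum>a\<leftarrow>u. min_square a))) (map to_z4 (row_combination u rs acc))"
  using assms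
proof (induction rs arbitrary: k acc u)
  case Nil
  then show ?case by (cases k) auto
next
  case (Cons r rs)
  show ?case
  proof (cases k)
    case 0
    then show ?thesis using Cons.prems row_combination_to_z4_0[of u "r # rs" acc] by simp
  next
    case (Suc m)
    obtain a u' where u: "u = a # u'" "length u' = length rs"
      using Cons.prems(2) by (cases u) simp_all
    define acc' where "acc' = map2 (\<lambda>x y. x + a * y) acc r"
    have len: "length r = length acc" using Cons.prems(3) by simp
    then have len': "\<And>s. s \<in> set rs \<Longrightarrow> length s = length acc'"
      using Cons.prems(3) unfolding acc'_def by simp
    have le: "min_square a + (\<Sum>a\<leftarrow>u'. min_square a) \<le> k" using Cons.prems(4) u by simp
    \<comment> \<open>The residue of \<open>a\<close> selects the branch. With
      \<open>k = Suc m\<close>, a residue 2 leaves the budget \<open>m - 3\<close>, and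
      \<open>le\<close> ensures \<open>m \<ge> 3\<close>, as the guard of that branch
      demands.\<close>
    have "light_sums_heavy (map (map to_z4) rs) (k - min_square a) (map to_z4 acc')"
      using Cons.prems(1) le len unfolding Suc acc'_def
      by (cases a rule: mod4_cases) (simp_all add: min_square_def add_multiple_to_z4 numeral_eq_Suc del: map_map)
    from Cons.IH[OF this u(2) len'] le show ?thesis
      unfolding u acc'_def by (simp add: diff_diff_eq)
  qed
qed

lemma light_sums_heavy_E_rows:
  "light_sums_heavy (map (map to_z4) E_rows) 5 (replicate 16 Z0)"
  by code_simp

lemma sum_list_upt: "(\<Sum>i\<leftarrow>[0..<n]. f i) = (\<Sum>i<n. f i)"
  by (simp add: interv_sum_list_conv_sum_set_nat lessThan_atLeast0)

lemma sum_split_32: "(\<Sum>l<32. f l) = (\<Sum>i<16. f i) + (\<Sum>j<16. f (16 + j))"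
  for f :: "nat \<Rightarrow> 'a::comm_monoid_add"
  using sum.atLeastLessThan_concat[of 0 16 32 f] sum.shift_bounds_nat_ivl[of f 0 16 16]
  by (simp add: lessThan_atLeast0 add.commute)

lemma codeword_zero_of_short:
  assumes cw: "codeword x" and short: "(\<Sum>i<16. (x i)^2) \<le> 5" "(\<Sum>l<32. (x l)^2) < 16"
    and l: "l < 32"
  shows "4 dvd x l"
proof -
  define u where "u = map x [0..<16]"
  define v where "v = map (\<lambda>j. x (16 + j)) [0..<16]"
  define W where "W = (\<Sum>a\<leftarrow>u. min_square a)"
  have W: "W = (\<Sum>i<16. min_square (x i))"
    unfolding W_def u_def by (simp only: map_map sum_list_upt o_def)
  have V: "(\<Sum>a\<leftarrow>v. min_square a) = (\<Sum>j<16. min_square (x (16 + j)))"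
    unfolding v_def by (simp only: map_map sum_list_upt o_def)
  have lenu: "length u = 16" unfolding u_def by simp
  have WU: "int W \<le> (\<Sum>i<16. (x i)^2)"
    unfolding W of_nat_sum by (intro sum_mono min_square_le)
  have VV: "int (\<Sum>a\<leftarrow>v. min_square a) \<le> (\<Sum>j<16. (x (16 + j))^2)"
    unfolding V of_nat_sum by (intro sum_mono min_square_le)
  have W5: "W \<le> 5" using WU short by simp
  have uE: "map to_z4 (times_E u) = map to_z4 v"
  proof (rule nth_equalityI)
    show "length (map to_z4 (times_E u)) = length (map to_z4 v)"
      using times_E_nth(1)[OF lenu, of 0] by (simp add: v_def)
    fix j assume "j < length (map to_z4 (times_E u))"
    then have j: "j < 16" using times_E_nth(1)[OF lenu, of 0] by simp
    have "[times_E u ! j = x (16 + j)] (mod 4)"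
      using cw j times_E_nth(2)[OF lenu j] by (simp add: u_def codeword_def cong_sym)
    then show "map to_z4 (times_E u) ! j = map to_z4 v ! j"
      using j times_E_nth(1)[OF lenu, of 0] by (simp add: v_def to_z4_cong)
  qed
  have "light_sums_heavy (map (map to_z4) E_rows) 5 (map to_z4 (replicate 16 0))"
    using light_sums_heavy_E_rows by (simp add: map_replicate to_z4_def)
  \<comment> \<open>The first alternative means \<open>W = 0\<close>, a first half divisible by 4;
    the second would bring both halves together to norm 16.\<close>
  then have "5 - W = 5 \<or> heavy (11 + (5 - W)) (map to_z4 v)"
    using light_sums_heavy_sound[of E_rows 5 "replicate 16 0" u] lenu E_rows_length W5
    unfolding uE[symmetric] times_E_def W_def by simp
  moreover have "\<not> heavy (11 + (5 - W)) (map to_z4 v)"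
  proof
    assume "heavy (11 + (5 - W)) (map to_z4 v)"
    then have "11 + (5 - W) \<le> (\<Sum>a\<leftarrow>v. min_square a)" by (rule heavy_min_square)
    then have "16 \<le> int W + int (\<Sum>a\<leftarrow>v. min_square a)" using W5 by linarith
    then show False using WU VV short(2) by (simp add: sum_split_32)
  qed
  ultimately have "W = 0" using W5 by simp
  then have u0: "4 dvd x i" if "i < 16" for i
    using that unfolding W by (auto simp: min_square_def split: if_splits)
  show ?thesis
  proof (cases "l < 16")
    case True
    then show ?thesis by (rule u0)
  next
    case False
    then obtain j where j: "l = 16 + j" using le_Suc_ex not_less by blast
    have "[x (16 + j) = (\<Sum>i<16. x i * E_entry i j)] (mod 4)"
      using cw l j by (simp add: codeword_def)
    moreover have "4 dvd (\<Sum>i<16. x i * E_entry i j)"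
      using u0 by (intro dvd_sum dvd_mult2) simp
    ultimately show ?thesis unfolding j using cong_dvd_iff by blast
  qed
qed

section \<open>Relations between the two halves of a codeword\<close>

lemma E_rows_orthogonal: "orthogonal_rows 19 E_rows"
  by code_simp

text \<open>From \<open>D^2 = -15\<close> follows \<open>E^2 = -11 + 4 * D\<close>.\<close>

lemma E_rows_involution:
  "map (\<lambda>r. map (\<lambda>a. a mod 4) (times_E r)) E_rows
    = map (\<lambda>i. map (\<lambda>j. if i = j then 1 else 0) [0..<16]) [0..<16]"
  by code_simp

lemma E_entry_mult_transpose:
  assumes "i < 16" "j < 16"
  shows "(\<Sum>l<16. E_entry i l * E_entry j l) = (if i = j then 19 else 0)"
  using orthogonal_rows_nth[OF E_rows_orthogonal, of i j] dot_eq_sum[of "E_rows ! i" "E_rows ! j"]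
    E_rows_length assms by simp

lemma E_entry_square:
  assumes "i < 16" "l < 16"
  shows "[(\<Sum>j<16. E_entry i j * E_entry j l) = (if i = l then 1 else 0)] (mod 4)"
proof -
  have len: "length (E_rows ! i) = 16" using assms E_rows_length by simp
  have "map (\<lambda>r. map (\<lambda>a. a mod 4) (times_E r)) E_rows ! i ! l = (if i = l then 1 else 0)"
    unfolding E_rows_involution using assms by simp
  then show ?thesis
    using assms E_rows_length times_E_nth[OF len assms(2)] by (simp add: cong_def)
qed

text \<open>Multiplying \<open>v \<equiv> u E\<close> by \<open>E\<close> gives
  \<open>v E \<equiv> u\<close> modulo 4.\<close>

lemma codeword_swap:
  assumes "codeword x"
  shows "codeword (\<lambda>l. if l < 16 then x (16 + l) else x (l - 16))"
  unfolding codeword_def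
proof (intro allI impI)
  fix l :: nat assume l: "l < 16"
  have "[(\<Sum>j<16. x (16 + j) * E_entry j l) = (\<Sum>j<16. (\<Sum>i<16. x i * E_entry i j) * E_entry j l)] (mod 4)"
    using assms by (intro cong_sum cong_mult) (auto simp: codeword_def)
  also have "(\<Sum>j<16. (\<Sum>i<16. x i * E_entry i j) * E_entry j l)
      = (\<Sum>i<16. x i * (\<Sum>j<16. E_entry i j * E_entry j l))"
    unfolding sum_distrib_left sum_distrib_right mult.assoc by (rule sum.swap)
  also have "[\<dots> = (\<Sum>i<16. x i * (if i = l then 1 else 0))] (mod 4)"
    using l by (intro cong_sum cong_mult E_entry_square) auto
  also have "(\<Sum>i<16. x i * (if i = l then 1 else 0)) = x l"
    using l by (simp add: if_distrib[of "(*) _"] cong: if_cong)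
  finally show "[(if 16 + l < 16 then x (16 + (16 + l)) else x (16 + l - 16))
      = (\<Sum>i<16. (if i < 16 then x (16 + i) else x (i - 16)) * E_entry i l)] (mod 4)"
    by (simp add: cong_sym)
qed

text \<open>Integers congruent modulo 4 have squares congruent modulo 8, and
  \<open>E E^T = 19\<close> makes the norm of \<open>u E\<close> equal to 19 times that of
  \<open>u\<close>.\<close>

lemma codeword_norm_halves:
  assumes "codeword x"
  shows "[(\<Sum>j<16. (x (16 + j))^2) = 3 * (\<Sum>i<16. (x i)^2)] (mod 8)"
proof -
  have sq: "[a^2 = b^2] (mod 8)" if "[a = b] (mod 4)" for a b :: int
  proof -
    obtain t where "a - b = 4 * t" using \<open>[a = b] (mod 4)\<close> unfolding cong_iff_dvd_diff by blast
    then have "a = b + 4 * t" by simp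
    then have "a^2 - b^2 = 8 * (b * t + 2 * t^2)" by (simp add: power2_eq_square algebra_simps)
    then show ?thesis by (simp add: cong_iff_dvd_diff)
  qed
  have "[(\<Sum>j<16. (x (16 + j))^2) = (\<Sum>j<16. (\<Sum>i<16. x i * E_entry i j)^2)] (mod 8)"
    using assms by (intro cong_sum sq) (auto simp: codeword_def)
  also have "(\<Sum>j<16. (\<Sum>i<16. x i * E_entry i j)^2)
      = (\<Sum>j<16. \<Sum>i<16. \<Sum>i'<16. x i * x i' * (E_entry i j * E_entry i' j))"
    by (simp add: power2_eq_square sum_product ac_simps)
  also have "\<dots> = (\<Sum>i<16. \<Sum>i'<16. \<Sum>j<16. x i * x i' * (E_entry i j * E_entry i' j))"
    by (subst sum.swap) (intro sum.cong refl sum.swap)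
  also have "\<dots> = (\<Sum>i<16. \<Sum>i'<16. x i * x i' * (if i = i' then 19 else 0))"
    by (simp add: E_entry_mult_transpose flip: sum_distrib_left)
  also have "\<dots> = (\<Sum>i<16. 19 * (x i)^2)"
    by (intro sum.cong refl) (simp add: if_distrib[of "(*) _"] power2_eq_square cong: if_cong)
  also have "\<dots> = 19 * (\<Sum>i<16. (x i)^2)" by (simp add: sum_distrib_left)
  also have "[19 * (\<Sum>i<16. (x i)^2) = 3 * (\<Sum>i<16. (x i)^2)] (mod 8)"
    by (simp add: cong_iff_dvd_diff)
  finally show ?thesis .
qed

lemma codeword_norm_ge_16:
  assumes cw: "codeword x" and norm: "(\<Sum>l<32. (x l)^2) = 4 * int k" "k > 0"
  shows "k \<ge> 4"
proof (rule ccontr)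
  assume "\<not> k \<ge> 4"
  then have lt: "(\<Sum>l<32. (x l)^2) < 16" using norm by simp
  have short: False if y: "codeword y" "(\<Sum>i<16. (y i)^2) \<le> 5" "(\<Sum>l<32. (y l)^2) = 4 * int k" for y
  proof -
    have "4 dvd y l" if "l < 32" for l using codeword_zero_of_short[OF y(1,2) _ that] lt y(3) norm(1) by simp
    \<comment> \<open>Coordinates divisible by 4 make \<open>4 * k\<close> a multiple of 16,
      impossible for \<open>0 < k < 4\<close>.\<close>
    then have "16 dvd (y l)^2" if "l < 32" for l using that dvd_power_same[of 4 "y l" 2] by simp
    then have "16 dvd (\<Sum>l<32. (y l)^2)" by (intro dvd_sum) simp
    then have "4 dvd k" unfolding y(3) by presburger
    then show False using \<open>\<not> k \<ge> 4\<close> norm(2) by (auto dest: dvd_imp_le)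
  qed
  define A where "A = (\<Sum>i<16. (x i)^2)"
  define B where "B = (\<Sum>j<16. (x (16 + j))^2)"
  have AB: "A + B = 4 * int k" using norm(1) unfolding A_def B_def by (simp add: sum_split_32)
  have "A > 5" using short[OF cw] norm unfolding A_def by fastforce
  moreover have "B > 5"
  proof (rule ccontr)
    assume "\<not> B > 5"
    then show False
      using short[OF codeword_swap[OF cw]] norm(1) by (simp add: sum_split_32 B_def add.commute)
  qed
  \<comment> \<open>Both halves have norm at least 6 and sum \<open>4 * k \<le> 12\<close>; but 6
    and 18 differ modulo 8.\<close>
  ultimately have "A = 6" "B = 6" using AB \<open>\<not> k \<ge> 4\<close> by linarith+
  then show False using codeword_norm_halves[OF cw] unfolding A_def B_def by (simp add: cong_def)
qed



theorem theorem4p11: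
  fixes k :: nat
  assumes "k > 0"
  shows "contains_frame 32 k L32 \<longleftrightarrow> k \<ge> 4"
proof
  assume "contains_frame 32 k L32"
  then obtain x where "codeword x" "(\<Sum>l<32. (x l)^2) = 4 * int k"
    by (rule frame_codeword)
  then show "k \<ge> 4" using codeword_norm_ge_16 assms by blast
next
  assume "k \<ge> 4"
  then show "contains_frame 32 k L32"
    using code_frame_exists code_frame_contains_frame by blast
qed

end
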